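(* Let $E$ be a disk in $\mathbb R^2$. Then there exists a homeomorphism $h:\mathbb R^2\to\mathbb R^2$ such that, for any $x\in\partial E$, the orbit $O(x,h)$ is bounded, but for any $y\in\mathrm{Int}(E)$, the orbit $O(y,h)$ is doubly divergent.
   Context: A subset $E$ of $\mathbb R^2$ is a disk if it is homeomorphic to the closed unit ball of $\mathbb R^2$; $\partial E$ and $\mathrm{Int}(E)$ denote its boundary and interior. For a homeomorphism $h:\mathbb R^2\to\mathbb R^2$ and $x\in\mathbb R^2$, the orbit of $x$ is $O(x,h)=\{h^n(x): n\in\mathbb Z\}$. Let $d$ be the Euclidean metric on $\mathbb R^2$. The orbit $O(x,h)$ is positively divergent if $d(h^n(x),(0,0))\to\infty$ as $n\to\infty$, negatively divergent if $d(h^{-n}(x),(0,0))\to\infty$ as $n\to\infty$, and doubly divergent if it is both positively divergent and negatively divergent. *)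

theory Defs
  imports "HOL-Analysis.Analysis"
begin

definition disk :: "(real^2) set \<Rightarrow> bool" where
  "disk E \<longleftrightarrow> E homeomorphic (cball 0 1 :: (real^2) set)"

text \<open>Integer iterates; meaningful only for bijective \<open>h\<close>.\<close>

definition iter :: "('a \<Rightarrow> 'a) \<Rightarrow> int \<Rightarrow> 'a \<Rightarrow> 'a" where
  "iter h n = (if 0 \<le> n then h ^^ nat n else (inv h) ^^ nat (- n))"

definition orbit :: "'a \<Rightarrow> ('a \<Rightarrow> 'a) \<Rightarrow> 'a set" where
  "orbit x h = range (\<lambda>n::int. iter h n x)"

definition positively_divergent :: "real^2 \<Rightarrow> (real^2 \<Rightarrow> real^2) \<Rightarrow> bool" where
  "positively_divergent x h \<longleftrightarrow>
     filterlim (\<lambda>n::nat. dist (iter h (int n) x) 0) at_top sequentially"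

definition negatively_divergent :: "real^2 \<Rightarrow> (real^2 \<Rightarrow> real^2) \<Rightarrow> bool" where
  "negatively_divergent x h \<longleftrightarrow>
     filterlim (\<lambda>n::nat. dist (iter h (- int n) x) 0) at_top sequentially"

definition doubly_divergent :: "real^2 \<Rightarrow> (real^2 \<Rightarrow> real^2) \<Rightarrow> bool" where
  "doubly_divergent x h \<longleftrightarrow> positively_divergent x h \<and> negatively_divergent x h"

end

theory Submission
  imports Defs
begin

text \<open>
  No Schoenflies theorem is needed.  Parametrize the disk by \<open>\<phi>\<close> and put \<open>\<phi> 0\<close> at the origin.
  For \<open>t \<ge> 0\<close> let \<open>f\<^sub>t\<close> be the following homeomorphism of the plane: shrink the disk towards
  the origin relative to its boundary; tilt it slightly, \<open>(x, y) \<mapsto> (x, y + u x)\<close> with \<open>u \<rightarrow> 0\<close>; then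
  push a tube around the horizontal axis to distance \<open>t\<close>, its width being \<open>o(u)\<close>.  Interior points
  end up in the core of the tube, so they are carried to infinity, whereas a boundary point, being
  fixed by the first map, leaves the tube for good, because the axis of the tube has slope \<open>-u\<close> in the
  untilted plane and the origin is not a boundary point.

  The map \<open>f\<^sub>t\<close> is the identity outside a horizontal strip and depends continuously on \<open>t\<close>.  Stack
  copies of the strip indexed by the integers and let \<open>F\<close> act on the copy number \<open>n\<close> as \<open>f\<close> at time
  \<open>t\<^sub>n\<close>, where \<open>t\<^sub>n \<rightarrow> \<infinity>\<close> as \<open>\<bar>n\<bar> \<rightarrow> \<infinity>\<close>; conjugate by \<open>F\<close> the shift that moves each copy to the next
  one.  If \<open>t\<^sub>n\<close> grows slowly enough, this conjugate moves first coordinates less and less as \<open>\<bar>n\<bar> \<rightarrow> \<infinity>\<close>.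
  Hence, after squeezing the second coordinate into \<open>(-1, 1)\<close>, it extends by the identity to the
  whole plane.  Orbits now have bounded second coordinate, and first coordinate that of \<open>f\<close> at
  time \<open>t\<^sub>n\<close>.
\<close>

section \<open>Tools: two-sided orbits, slowly divergent sequences, moduli of continuity, tent
  perturbations\<close>

text \<open>Reduces a whole two-sided orbit to one forward step; injectivity of \<open>h\<close>
  turns that step into the backward one.\<close>

lemma iter_eqI:
  assumes "bij h" "g 0 = x" "\<And>n::int. h (g n) = g (n + 1)"
  shows "iter h n x = g n"
proof -
  have pos: "(h ^^ k) x = g (int k)" for k
    by (induction k) (use assms in \<open>auto simp: add.commute\<close>)
  have inv: "inv h (g n) = g (n - 1)" for n
    using assms(3)[of "n - 1"] bij_is_inj[OF assms(1)] by (metis diff_add_cancel inv_f_f)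
  have neg: "(inv h ^^ k) x = g (- int k)" for k
  proof (induction k)
    case (Suc k)
    have "- int (Suc k) = - int k - 1"
      by simp
    with Suc inv show ?case
      by (metis comp_apply funpow.simps(2))
  qed (simp add: assms)
  show ?thesis
    using pos[of "nat n"] neg[of "nat (- n)"] by (simp add: iter_def)
qed

text \<open>Greedy recursion: the step taken at height \<open>s\<close> depends only on
  \<open>\<lfloor>s\<rfloor>\<close>, so it is bounded below as long as the heights stay bounded,
  which forces divergence.\<close>

lemma slow_sequence:
  fixes \<delta> :: "nat \<Rightarrow> real"
  assumes "\<And>j. \<delta> j > 0"
  obtains t :: "nat \<Rightarrow> real" where "t 0 = 0" "\<And>n. t n \<le> t (Suc n)" "\<And>n. t (Suc n) \<le> t n + 1"
    "\<And>n. t (Suc n) \<le> t n + \<delta> (nat \<lfloor>t n\<rfloor>)" "filterlim t at_top sequentially"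
proof -
  \<comment> \<open>Running minima, capped at \<open>1\<close>, make the step nonincreasing in the
    height.\<close>
  define \<Delta> where "\<Delta> j = Min (insert 1 (\<delta> ` {..j}))" for j
  have pos: "\<Delta> j > 0" for j
    using assms by (auto simp: \<Delta>_def)
  have le1: "\<Delta> j \<le> 1" and le\<delta>: "\<Delta> j \<le> \<delta> j" for j
    by (auto simp del: Min_insert simp: \<Delta>_def intro!: Min_le)
  have anti: "\<Delta> j \<le> \<Delta> i" if "i \<le> j" for i j
    unfolding \<Delta>_def using that by (intro Min_antimono) auto
  define t where "t n = ((\<lambda>s. s + \<Delta> (nat \<lfloor>s\<rfloor>)) ^^ n) (0::real)" for n
  have t_Suc: "t (Suc n) = t n + \<Delta> (nat \<lfloor>t n\<rfloor>)" for n
    by (simp add: t_def)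
  have mono: "incseq t"
    by (intro incseq_SucI) (simp add: t_Suc pos less_imp_le)
  have "\<exists>n. t n \<ge> B" for B
  proof (rule ccontr)
    assume "\<not> ?thesis"
    then have B: "t n < B" for n
      by (simp add: not_le)
    \<comment> \<open>Below the bound \<open>B\<close> every step is at least this \<open>c\<close>,
      so \<open>t\<close> would grow at least linearly.\<close>
    define c where "c = \<Delta> (nat \<lfloor>B\<rfloor>)"
    have c: "c \<le> \<Delta> (nat \<lfloor>t n\<rfloor>)" for n
      unfolding c_def using B[of n] by (intro anti nat_mono floor_mono) simp
    then have "real n * c \<le> t n" for n
    proof (induction n)
      case (Suc n)
      then show ?case
        using add_mono[OF Suc.IH c[of n]] by (simp add: t_Suc algebra_simps)
    qed (simp add: t_def)
    moreover have "c > 0"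
      by (simp add: c_def pos)
    then obtain n where "real n * c > B"
      using ex_less_of_nat_mult by blast
    ultimately show False
      using B by (meson less_le_not_le order_trans less_imp_le)
  qed
  then have "filterlim t at_top sequentially"
    using mono by (metis eventually_sequentiallyI filterlim_at_top incseq_def order_trans)
  then show ?thesis
    using that[of t] t_Suc le1 le\<delta> pos by (simp add: t_def less_imp_le)
qed

text \<open>Distance to the hypograph of \<open>norm \<circ> \<phi>\<close>, which unlike the optimal modulus is continuous in \<open>\<eta>\<close>.\<close>

lemma continuous_modulus_at_0:
  fixes \<phi> :: "'b::euclidean_space \<Rightarrow> 'a::real_normed_vector"
  assumes cont: "continuous_on (cball 0 1) \<phi>" and "\<phi> 0 = 0"
  obtains D :: "real \<Rightarrow> real" where "continuous_on UNIV D" "\<And>\<eta>. \<eta> > 0 \<Longrightarrow> D \<eta> > 0"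
    "\<And>\<eta> z. \<lbrakk>norm z \<le> 1; norm z < D \<eta>\<rbrakk> \<Longrightarrow> norm (\<phi> z) < \<eta>"
proof -
  define G where "G = {p :: 'b \<times> real. fst p \<in> cball 0 1 \<and> snd p \<le> norm (\<phi> (fst p))}"
  have "closed G"
  proof -
    have "closed {p \<in> cball (0::'b) 1 \<times> (UNIV::real set). snd p \<le> norm (\<phi> (fst p))}"
      by (intro continuous_on_closed_Collect_le closed_Times closed_cball closed_UNIV continuous_intros
          continuous_on_compose2[OF cont]) auto
    then show ?thesis
      by (simp add: G_def mem_Times_iff)
  qed
  have ne: "G \<noteq> {}"
    by (auto simp: G_def intro!: exI[of _ "0::'b"] exI[of _ "0::real"])
  define D where "D \<eta> = infdist (0::'b, \<eta>) G" for \<eta> :: real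
  show ?thesis
  proof
    show "continuous_on UNIV D"
      unfolding D_def by (intro continuous_intros)
    \<comment> \<open>Since \<open>\<phi> 0 = 0\<close>, the point \<open>(0, \<eta>)\<close> lies
      outside the closed set \<open>G\<close>.\<close>
    show "D \<eta> > 0" if "\<eta> > 0" for \<eta>
      unfolding D_def using that assms(2)
      by (intro infdist_pos_not_in_closed \<open>closed G\<close> ne) (auto simp: G_def)
    show "norm (\<phi> z) < \<eta>" if "norm z \<le> 1" "norm z < D \<eta>" for \<eta> z
    proof (rule ccontr)
      assume "\<not> norm (\<phi> z) < \<eta>"
      then have "(z, \<eta>) \<in> G"
        using that by (auto simp: G_def)
      then have "D \<eta> \<le> dist (0, \<eta>) (z, \<eta>)"
        unfolding D_def by (rule infdist_le)
      with that show False
        by (simp add: dist_Pair_Pair)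
    qed
  qed
qed

text \<open>The tent is 1-Lipschitz, so the perturbation is a strict contraction, which gives
  injectivity. It vanishes where \<open>\<bar>\<delta>\<bar> \<le> \<bar>y\<bar>\<close>, so
  surjectivity follows from the intermediate value theorem.\<close>

lemma bij_tent_perturbation:
  fixes c \<delta> :: real
  assumes "\<bar>c\<bar> < 1"
  shows "bij (\<lambda>y. y + c * max 0 (\<delta> - \<bar>y\<bar>))" (is "bij ?g")
proof (rule bijI)
  show "inj ?g"
  proof (rule injI)
    fix y z assume eq: "?g y = ?g z"
    have "\<bar>max 0 (\<delta> - \<bar>z\<bar>) - max 0 (\<delta> - \<bar>y\<bar>)\<bar> \<le> \<bar>y - z\<bar>"
      by linarith
    then have "\<bar>c\<bar> * \<bar>max 0 (\<delta> - \<bar>z\<bar>) - max 0 (\<delta> - \<bar>y\<bar>)\<bar> \<le> \<bar>c\<bar> * \<bar>y - z\<bar>"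
      by (intro mult_left_mono) auto
    moreover have "y - z = c * (max 0 (\<delta> - \<bar>z\<bar>) - max 0 (\<delta> - \<bar>y\<bar>))"
      using eq by (simp add: algebra_simps)
    ultimately have "\<bar>y - z\<bar> \<le> \<bar>c\<bar> * \<bar>y - z\<bar>"
      by (metis abs_mult)
    with assms show "y = z"
      by (metis abs_ge_zero abs_le_zero_iff eq_iff_diff_eq_0 leD mult_less_cancel_right2 not_le order.not_eq_order_implies_strict)
  qed
  show "surj ?g"
  proof -
    have "\<exists>y. v = ?g y" for v
    proof -
      define B where "B = \<bar>v\<bar> + \<bar>\<delta>\<bar>"
      have "\<exists>y\<ge>-B. y \<le> B \<and> ?g y = v"
        by (intro IVT') (auto simp: B_def intro!: continuous_intros)
      then show ?thesis
        by metis
    qed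
    then show ?thesis
      unfolding surj_def by blast
  qed
qed

subsection \<open>The finger isotopy\<close>

text \<open>For \<open>a \<ge> 0\<close> a homeomorphism of the closed unit ball fixing the sphere;
  as \<open>a\<close> grows, every interior point tends to the centre.\<close>

definition shrink :: "real \<Rightarrow> 'b::real_normed_vector \<Rightarrow> 'b" where
  "shrink a z = z /\<^sub>R (1 + a * (1 - norm z))"

lemma shrink_denom_pos:
  assumes "0 \<le> a" "norm z \<le> 1"
  shows "0 < 1 + a * (1 - norm z)"
  using assms by (simp add: add_pos_nonneg)

lemma norm_shrink:
  assumes "0 \<le> a" "norm z \<le> 1"
  shows "norm (shrink a z) = norm z / (1 + a * (1 - norm z))"
  using shrink_denom_pos[OF assms] by (simp add: shrink_def divide_inverse mult.commute)

lemma shrink_on_sphere [simp]: "norm z = 1 \<Longrightarrow> shrink a z = z"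
  by (simp add: shrink_def)

lemma shrink_0 [simp]: "shrink 0 z = z"
  by (simp add: shrink_def)

lemma bij_betw_shrink:
  assumes "0 \<le> a"
  shows "bij_betw (shrink a) (cball 0 1) (cball (0::'b::real_normed_vector) 1)"
proof -
  \<comment> \<open>Solving \<open>s = r / (1 + a * (1 - r))\<close> for \<open>r\<close> gives
    \<open>r = (1 + a) * s / (1 + a * s)\<close>, the radial profile of the inverse.\<close>
  define g :: "'b \<Rightarrow> 'b" where "g w = ((1 + a) / (1 + a * norm w)) *\<^sub>R w" for w
  have pos: "1 + a * norm w > 0" for w :: 'b
    using assms by (simp add: add_pos_nonneg)
  show ?thesis
  proof (rule bij_betw_byWitness[where f' = g])
    show "\<forall>z\<in>cball 0 1. g (shrink a z) = z"
    proof
      fix z :: 'b assume "z \<in> cball 0 1"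
      then have z: "norm z \<le> 1"
        by simp
      have d: "1 + a * (1 - norm z) > 0"
        using shrink_denom_pos[OF assms z] .
      have "1 + a * norm (shrink a z) = (1 + a) / (1 + a * (1 - norm z))"
        using d by (simp add: norm_shrink[OF assms z] field_simps)
      then show "g (shrink a z) = z"
        using d assms by (simp add: g_def shrink_def)
    qed
    show "\<forall>w\<in>cball 0 1. shrink a (g w) = w"
    proof
      fix w :: 'b assume w: "w \<in> cball 0 1"
      have n: "norm (g w) = (1 + a) * norm w / (1 + a * norm w)"
        using pos[of w] assms by (simp add: g_def)
      have "1 + a * (1 - norm (g w)) = (1 + a) / (1 + a * norm w)"
        unfolding n using pos[of w] by (simp add: divide_simps) (simp add: algebra_simps)
      then show "shrink a (g w) = w"
        using pos[of w] assms by (simp add: g_def shrink_def)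
    qed
    show "shrink a ` cball 0 1 \<subseteq> cball (0::'b) 1"
    proof clarsimp
      fix z :: 'b assume z: "norm z \<le> 1"
      have "norm z * 1 \<le> 1 * (1 + a * (1 - norm z))"
        using z assms by (intro mult_mono) auto
      then show "norm (shrink a z) \<le> 1"
        using shrink_denom_pos[OF assms z] by (simp add: norm_shrink[OF assms z])
    qed
    show "g ` cball 0 1 \<subseteq> cball 0 1"
    proof clarsimp
      fix w :: 'b assume w: "norm w \<le> 1"
      have "(1 + a) * norm w \<le> 1 + a * norm w"
        using w by (simp add: algebra_simps)
      then show "norm (g w) \<le> 1"
        using pos[of w] assms by (simp add: g_def)
    qed
  qed
qed

section \<open>Tilting the plane and pushing the tube\<close>

lemma bij_fst_shear: "bij (\<lambda>v::real \<times> real. (fst v + g (snd v), snd v))"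
  by (rule bij_betw_byWitness[where f' = "\<lambda>v. (fst v - g (snd v), snd v)"]) auto

lemma bij_on_fibres:
  assumes "\<And>x. bij (g x)"
  shows "bij (\<lambda>v. (fst v, g (fst v) (snd v)))"
  by (rule bij_betw_byWitness[where f' = "\<lambda>v. (fst v, inv (g (fst v)) (snd v))"])
     (auto simp: bij_is_inj[OF assms] bij_is_surj[OF assms] surj_f_inv_f)

text \<open>The last factor makes \<open>tilt t\<close> the identity outside the strip \<open>\<bar>y\<bar> < 1 / 4\<close>.\<close>

definition tilt :: "real \<Rightarrow> real \<times> real \<Rightarrow> real \<times> real" where
  "tilt t v = (fst v, snd v + t / (1 + t)^2 * max (-1) (min 1 (fst v)) * max 0 (1 / 4 - \<bar>snd v\<bar>))"

text \<open>
  The half-width \<open>t / (4 * (1 + t)^3)\<close> of the tube stays below \<open>1 / 4\<close> and tends to \<open>0\<close> faster than the slope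
  \<open>t / (1 + t)^2\<close> in \<open>tilt\<close>.
\<close>

definition push :: "real \<Rightarrow> real \<times> real \<Rightarrow> real \<times> real" where
  "push t v = (fst v + max 0 (t - 4 * (1 + t)^3 * \<bar>snd v\<bar>), snd v)"

lemma tilt_coeff_bound:
  assumes "0 \<le> (t::real)"
  shows "0 \<le> t / (1 + t)^2" "t / (1 + t)^2 \<le> 1 / (1 + t)" "t / (1 + t)^2 < 1"
proof -
  show "0 \<le> t / (1 + t)^2"
    by (simp add: assms)
  show "t / (1 + t)^2 \<le> 1 / (1 + t)"
    using assms by (simp add: power2_eq_square divide_simps) 
  show "t / (1 + t)^2 < 1"
    using assms by (simp add: power2_eq_square divide_simps) (simp add: algebra_simps add_pos_nonneg)
qed

text \<open>Each vertical line undergoes a tent perturbation; clipping the first coordinate keeps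
  its coefficient below \<open>1\<close> in absolute value.\<close>

lemma bij_tilt:
  assumes "0 \<le> t"
  shows "bij (tilt t)"
proof -
  have "bij (\<lambda>y. y + t / (1 + t)^2 * max (-1) (min 1 x) * max 0 (1 / 4 - \<bar>y\<bar>))" for x
  proof (rule bij_tent_perturbation)
    have "\<bar>t / (1 + t)^2 * max (-1) (min 1 x)\<bar> = t / (1 + t)^2 * \<bar>max (-1) (min 1 x)\<bar>"
      using assms by (simp add: abs_mult)
    also have "\<dots> \<le> t / (1 + t)^2 * 1"
      using tilt_coeff_bound[OF assms] by (intro mult_left_mono) auto
    finally show "\<bar>t / (1 + t)^2 * max (-1) (min 1 x)\<bar> < 1"
      using tilt_coeff_bound[OF assms] by simp
  qed
  from bij_on_fibres[OF this] show ?thesis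
    by (simp add: tilt_def[abs_def])
qed

lemma bij_push: "bij (push t)"
  unfolding push_def[abs_def] by (rule bij_fst_shear)

lemma push_outside:
  assumes "0 \<le> t" "1 / 4 \<le> \<bar>snd v\<bar>"
  shows "push t v = v"
proof -
  have "1 + t \<le> (1 + t)^3"
    using assms by (intro self_le_power) auto
  moreover have "4 * (1 + t)^3 * (1 / 4) \<le> 4 * (1 + t)^3 * \<bar>snd v\<bar>"
    using assms by (intro mult_left_mono) auto
  ultimately have "t - 4 * (1 + t)^3 * \<bar>snd v\<bar> \<le> 0"
    by simp
  then show ?thesis
    by (simp add: push_def)
qed

lemma tilt_outside: "1 / 4 \<le> \<bar>snd v\<bar> \<Longrightarrow> tilt t v = v"
  by (simp add: tilt_def)

lemma fst_tilt [simp]: "fst (tilt t v) = fst v"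
  by (simp add: tilt_def)

text \<open>After tilting, the height is still at most twice the norm of \<open>v\<close>, so at
  this radius the displacement by \<open>push\<close> falls short of its peak \<open>t\<close> by at
  most \<open>1\<close>.\<close>

lemma push_tilt_core:
  assumes "0 \<le> t" "norm v < 1 / (8 * (1 + t)^3)"
  shows "fst v + t - 1 \<le> fst (push t (tilt t v))"
proof -
  obtain x y where v: "v = (x, y)"
    by force
  have xy: "\<bar>x\<bar> \<le> norm v" "\<bar>y\<bar> \<le> norm v"
    using norm_fst_le[of x y] norm_snd_le[of y x] by (auto simp: v)
  define p where "p = t / (1 + t)^2 * max (-1) (min 1 x) * max 0 (1 / 4 - \<bar>y\<bar>)"
  have "\<bar>p\<bar>
      = t / (1 + t)^2 * \<bar>max (-1) (min 1 x)\<bar> * \<bar>max 0 (1 / 4 - \<bar>y\<bar>)\<bar>"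
    using assms(1) by (simp add: p_def abs_mult)
  also have "\<dots> \<le> 1 * \<bar>x\<bar> * 1"
    using tilt_coeff_bound[OF assms(1)] by (intro mult_mono) auto
  also have "\<dots> \<le> norm v"
    using xy by simp
  finally have "\<bar>snd (tilt t v)\<bar> \<le> 2 * norm v"
    using xy by (simp only: tilt_def v fst_conv snd_conv flip: p_def)
  moreover have "4 * (1 + t)^3 * (2 * norm v) \<le> 1"
    using assms by (simp add: field_simps)
  ultimately have "4 * (1 + t)^3 * \<bar>snd (tilt t v)\<bar> \<le> 1"
    using assms(1) by (smt (verit) mult_left_mono zero_le_power)
  then show ?thesis
    by (simp add: push_def max_def)
qed

text \<open>On the axis, where \<open>\<bar>x\<bar> \<le> 1\<close> makes the clipping inactive,
  tilting lifts the point by \<open>t * \<bar>x\<bar> / (4 * (1 + t)^2)\<close>, eventually more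
  than the half-width of the tube. Off the axis the tilt displacement and the width both tend to
  \<open>0\<close>, so the point is eventually left outside.\<close>

lemma push_tilt_eventually_trivial:
  assumes v: "v \<noteq> 0" "\<bar>fst v\<bar> \<le> 1"
  shows "eventually (\<lambda>t. fst (push t (tilt t v)) = fst v) at_top"
proof -
  obtain x y where xy: "v = (x, y)"
    by force
  \<comment> \<open>The coordinate responsible for leaving the tube. The threshold
    \<open>2 / c\<close> makes the tilt displacement at most \<open>c / 2\<close> when
    \<open>y \<noteq> 0\<close>.\<close>
  define c where "c = (if y = 0 then \<bar>x\<bar> else \<bar>y\<bar>)"
  have "c > 0"
    using v by (auto simp: c_def xy zero_prod_def)
  have "fst (push t (tilt t v)) = fst v" if t: "t \<ge> 2 / c" "t \<ge> 0" for t
  proof -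
    have tc: "2 \<le> (1 + t) * c"
      using t \<open>c > 0\<close> by (simp add: field_simps)
    have "t \<le> 4 * (1 + t)^3 * \<bar>snd (tilt t v)\<bar>"
    proof (cases "y = 0")
      case True
      then have "snd (tilt t v) = t / (1 + t)^2 * x / 4"
        using v by (auto simp: tilt_def xy)
      then have "4 * (1 + t)^3 * \<bar>snd (tilt t v)\<bar> = 4 * (1 + t)^3 * (t / (1 + t)^2 * c / 4)"
        using True t by (simp add: c_def abs_mult)
      also have "\<dots> = t * ((1 + t) * c)"
        using t by (simp add: power2_eq_square power3_eq_cube)
      finally show ?thesis
        using mult_left_mono[of 1 "(1 + t) * c" t] t tc by simp
    next
      case False
      define p where "p = t / (1 + t)^2 * max (-1) (min 1 x) * max 0 (1 / 4 - \<bar>y\<bar>)"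
      have "\<bar>p\<bar>
          = t / (1 + t)^2 * \<bar>max (-1) (min 1 x)\<bar> * \<bar>max 0 (1 / 4 - \<bar>y\<bar>)\<bar>"
        using t(2) by (simp add: p_def abs_mult)
      also have "\<dots> \<le> (1 / (1 + t)) * 1 * 1"
        using tilt_coeff_bound[OF t(2)] t by (intro mult_mono) auto
      also have "\<dots> \<le> c / 2"
        using tc t by (simp add: field_simps)
      finally have s: "c / 2 \<le> \<bar>snd (tilt t v)\<bar>"
        using False by (simp only: tilt_def xy c_def fst_conv snd_conv if_False flip: p_def)
      have "1 * 2 \<le> (1 + t)^2 * ((1 + t) * c)"
        using tc t by (intro mult_mono one_le_power) auto
      moreover have "(1 + t) * 2 \<le> (1 + t) * ((1 + t) * c)"
        using tc t by (intro mult_left_mono) auto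
      moreover have "(1 + t) * ((1 + t) * c) * 1 \<le> (1 + t) * ((1 + t) * c) * (1 + t)"
        using t \<open>c > 0\<close> by (intro mult_left_mono) auto
      ultimately have "t \<le> 4 * (1 + t)^3 * (c / 2)"
        using t by (simp add: power3_eq_cube algebra_simps)
      also have "\<dots> \<le> 4 * (1 + t)^3 * \<bar>snd (tilt t v)\<bar>"
        using s t by (intro mult_left_mono) auto
      finally show ?thesis .
    qed
    then show ?thesis
      by (simp add: push_def)
  qed
  then show ?thesis
    unfolding eventually_at_top_linorder by (intro exI[of _ "max 0 (2 / c)"]) auto
qed

lemma continuous_on_shrink [continuous_intros]:
  assumes "continuous_on S f" "continuous_on S g" "\<And>x. x \<in> S \<Longrightarrow> 0 \<le> f x \<and> norm (g x) \<le> 1"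
  shows "continuous_on S (\<lambda>x. shrink (f x) (g x))"
  unfolding shrink_def
  by (intro continuous_intros assms(1,2)) (metis assms(3) shrink_denom_pos less_irrefl)

lemma continuous_on_tilt [continuous_intros]:
  assumes "continuous_on S f" "continuous_on S g" "\<And>x. x \<in> S \<Longrightarrow> 0 \<le> f x"
  shows "continuous_on S (\<lambda>x. tilt (f x) (g x))"
  unfolding tilt_def
  by (intro continuous_intros assms(1,2)) (metis assms(3) add_nonneg_eq_0_iff power_eq_0_iff zero_le_one zero_neq_one)

lemma continuous_on_push [continuous_intros]:
  assumes "continuous_on S f" "continuous_on S g"
  shows "continuous_on S (\<lambda>x. push (f x) (g x))"
  unfolding push_def by (intro continuous_intros assms(1,2))

section \<open>The finger isotopy of a disk centred at the origin\<close>

text \<open>The bounds in \<open>small\<close> keep the disk inside the strip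
  \<open>\<bar>y\<bar> < 1 / 4\<close> and in the range where \<open>tilt\<close> does not
  clip.\<close>

locale centred_disk =
  fixes \<phi> :: "real^2 \<Rightarrow> real \<times> real" and D :: "real \<Rightarrow> real"
  assumes cont: "continuous_on (cball 0 1) \<phi>"
    and inj: "inj_on \<phi> (cball 0 1)"
    and centre: "\<phi> 0 = 0"
    and small: "\<And>z. norm z \<le> 1 \<Longrightarrow> \<bar>fst (\<phi> z)\<bar> \<le> 1 \<and> \<bar>snd (\<phi> z)\<bar> \<le> 1 / 8"
    and cont_D: "continuous_on UNIV D"
    and D_pos: "\<And>\<eta>. \<eta> > 0 \<Longrightarrow> D \<eta> > 0"
    and modulus: "\<And>\<eta> z. \<lbrakk>norm z \<le> 1; norm z < D \<eta>\<rbrakk> \<Longrightarrow> norm (\<phi> z) < \<eta>"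
begin

definition E where "E = \<phi> ` cball 0 1"

definition \<psi> where "\<psi> = inv_into (cball 0 1) \<phi>"

text \<open>
  Chosen such that \<open>shrink (rate t)\<close> eventually sends a given interior point into the ball that \<open>\<phi>\<close>
  maps into the core of the tube at time \<open>t\<close>.
\<close>

definition rate :: "real \<Rightarrow> real" where
  "rate t = t / D (1 / (8 * (1 + t)^3))"

definition squeeze :: "real \<Rightarrow> real \<times> real \<Rightarrow> real \<times> real" where
  "squeeze t v = (if v \<in> E then \<phi> (shrink (rate t) (\<psi> v)) else v)"

text \<open>The map \<open>f\<^sub>t\<close> of the outline.\<close>

definition finger :: "real \<Rightarrow> real \<times> real \<Rightarrow> real \<times> real" where
  "finger t v = push t (tilt t (squeeze t v))"

lemma compact_E: "compact E"
  unfolding E_def by (intro compact_continuous_image cont compact_cball)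

lemma \<psi>_\<phi> [simp]: "norm z \<le> 1 \<Longrightarrow> \<psi> (\<phi> z) = z"
  by (simp add: \<psi>_def inj)

lemma \<phi>_\<psi>: "v \<in> E \<Longrightarrow> \<phi> (\<psi> v) = v"
  unfolding \<psi>_def E_def by (rule f_inv_into_f)

lemma norm_\<psi>: "v \<in> E \<Longrightarrow> norm (\<psi> v) \<le> 1"
  by (auto simp: E_def)

lemma cont_\<psi>: "continuous_on E \<psi>"
  unfolding E_def by (rule continuous_on_inv[OF cont compact_cball]) auto

lemma E_small: "v \<in> E \<Longrightarrow> \<bar>fst v\<bar> \<le> 1 \<and> \<bar>snd v\<bar> \<le> 1 / 8"
  using small by (auto simp: E_def)

lemma rate_nonneg: "0 \<le> t \<Longrightarrow> 0 \<le> rate t"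
  unfolding rate_def by (intro divide_nonneg_pos D_pos) auto

lemma continuous_on_rate: "continuous_on {0..} rate"
  unfolding rate_def
proof (intro continuous_intros continuous_on_compose2[OF cont_D] ballI)
  fix t :: real assume "t \<in> {0..}"
  then show "8 * (1 + t)^3 \<noteq> 0" "D (1 / (8 * (1 + t)^3)) \<noteq> 0"
    using D_pos[of "1 / (8 * (1 + t)^3)"] by auto
qed auto

lemma open_image_ball: "open (\<phi> ` ball 0 1)"
proof -
  have "continuous_on (ball 0 1) \<phi>" "inj_on \<phi> (ball 0 1)"
    using cont inj ball_subset_cball by (auto intro: continuous_on_subset inj_on_subset)
  then show ?thesis
    by (intro invariance_of_domain_gen) auto
qed

text \<open>The image of the open ball is open, hence inside \<open>interior E\<close>, so only the
  sphere can reach the frontier.\<close>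

lemma norm_\<psi>_frontier:
  assumes "v \<in> frontier E"
  shows "v \<in> E" "norm (\<psi> v) = 1"
proof -
  have "closed E"
    by (simp add: compact_E compact_imp_closed)
  then show v: "v \<in> E"
    using assms frontier_subset_closed by blast
  have "\<phi> ` ball 0 1 \<subseteq> interior E"
    by (rule interior_maximal[OF _ open_image_ball]) (auto simp: E_def)
  then have "v \<notin> \<phi> ` ball 0 1"
    using assms by (auto simp: frontier_def)
  then have "\<psi> v \<notin> ball 0 1"
    using \<phi>_\<psi>[OF v] by (metis imageI)
  then show "norm (\<psi> v) = 1"
    using norm_\<psi>[OF v] by simp
qed

lemma squeeze_fixes_boundary: "norm (\<psi> v) = 1 \<Longrightarrow> squeeze t v = v"
  by (simp add: squeeze_def \<phi>_\<psi>)

lemma bij_squeeze: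
  assumes "0 \<le> t"
  shows "bij (squeeze t)"
proof -
  have \<phi>: "bij_betw \<phi> (cball 0 1) E"
    by (simp add: bij_betw_def E_def inj)
  then have "bij_betw (\<phi> \<circ> (shrink (rate t) \<circ> \<psi>)) E E"
    using bij_betw_trans[OF bij_betw_trans[OF bij_betw_inv_into[OF \<phi>] bij_betw_shrink[OF rate_nonneg[OF assms]]] \<phi>]
    by (simp add: \<psi>_def comp_def)
  then have "bij_betw (squeeze t) E E"
    by (rule bij_betw_cong[THEN iffD1, rotated]) (simp add: squeeze_def)
  moreover have "bij_betw (squeeze t) (- E) (- E)"
    by (rule bij_betw_cong[THEN iffD2, OF _ bij_betw_id]) (simp add: squeeze_def)
  ultimately have "bij_betw (squeeze t) (E \<union> - E) (E \<union> - E)"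
    by (rule bij_betw_combine) auto
  then show ?thesis
    by simp
qed

text \<open>Two closed pieces are glued, over \<open>E\<close> and over the closure of its
  complement. They overlap over the frontier of \<open>E\<close>, where shrinking changes
  nothing.\<close>

lemma continuous_on_squeeze: "continuous_on ({0..} \<times> UNIV) (\<lambda>p. squeeze (fst p) (snd p))"
proof -
  have "continuous_on ({0..} \<times> E \<union> {0..} \<times> closure (- E))
    (\<lambda>p. if snd p \<in> E then \<phi> (shrink (rate (fst p)) (\<psi> (snd p))) else snd p)"
  proof (rule continuous_on_cases)
    show "closed ({0::real..} \<times> E)" "closed ({0::real..} \<times> closure (- E))"
      by (intro closed_Times closed_atLeast closed_closure compact_imp_closed[OF compact_E])+
    show "continuous_on ({0..} \<times> E) (\<lambda>p. \<phi> (shrink (rate (fst p)) (\<psi> (snd p))))"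
    proof (rule continuous_on_compose2[OF cont])
      show "continuous_on ({0..} \<times> E) (\<lambda>p. shrink (rate (fst p)) (\<psi> (snd p)))"
        by (intro continuous_intros continuous_on_compose2[OF continuous_on_rate]
            continuous_on_compose2[OF cont_\<psi>]) (auto simp: rate_nonneg norm_\<psi>)
      show "(\<lambda>p. shrink (rate (fst p)) (\<psi> (snd p))) ` ({0..} \<times> E) \<subseteq> cball 0 1"
        using bij_betw_shrink[OF rate_nonneg, THEN bij_betw_imp_surj_on] norm_\<psi>
        by (fastforce simp: image_subset_iff)
    qed
    show "continuous_on ({0..} \<times> closure (- E)) snd"
      by (intro continuous_intros)
    show "\<forall>p. p \<in> {0..} \<times> E \<and> snd p \<notin> E \<or> p \<in> {0..} \<times> closure (- E) \<and> snd p \<in> E \<longrightarrow>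
        \<phi> (shrink (rate (fst p)) (\<psi> (snd p))) = snd p"
    proof clarsimp
      fix t x y assume "(x, y) \<in> closure (- E)" "(x, y) \<in> E"
      then have "(x, y) \<in> frontier E"
        by (auto simp: frontier_def closure_complement closure_subset[THEN subsetD])
      then show "\<phi> (shrink (rate t) (\<psi> (x, y))) = (x, y)"
        by (simp add: norm_\<psi>_frontier \<phi>_\<psi>)
    qed
  qed
  moreover have "{0..} \<times> E \<union> {0..} \<times> closure (- E) = {0::real..} \<times> UNIV"
    using closure_subset[of "- E"] by auto
  ultimately show ?thesis
    by (simp add: squeeze_def[abs_def])
qed

lemma continuous_on_finger: "continuous_on ({0..} \<times> UNIV) (\<lambda>p. finger (fst p) (snd p))"
  unfolding finger_def by (intro continuous_intros continuous_on_squeeze) auto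

lemma bij_finger:
  assumes "0 \<le> t"
  shows "bij (finger t)"
proof -
  have "bij (push t \<circ> (tilt t \<circ> squeeze t))"
    by (intro bij_comp bij_push bij_tilt bij_squeeze assms)
  then show ?thesis
    by (simp add: finger_def[abs_def] comp_def)
qed

lemma continuous_finger:
  assumes "0 \<le> t"
  shows "continuous_on UNIV (finger t)"
proof -
  have "continuous_on UNIV (\<lambda>v. finger (fst (t, v)) (snd (t, v)))"
    by (rule continuous_on_compose2[OF continuous_on_finger]) (use assms in \<open>auto intro!: continuous_intros\<close>)
  then show ?thesis
    by simp
qed

lemma squeeze_0: "squeeze 0 v = v"
  by (simp add: squeeze_def rate_def \<phi>_\<psi>)

lemma finger_0: "finger 0 v = v"
  by (simp add: finger_def squeeze_0 tilt_def push_def)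

lemma finger_outside:
  assumes "0 \<le> t" "1 / 4 \<le> \<bar>snd v\<bar>"
  shows "finger t v = v"
proof -
  have "v \<notin> E"
    using E_small[of v] assms by auto
  with assms show ?thesis
    by (simp add: finger_def squeeze_def tilt_outside push_outside)
qed

text \<open>Squeezing fixes \<open>\<phi> z\<close>, and injectivity keeps it away from the origin
  \<open>\<phi> 0\<close>, so the tube eventually misses it.\<close>

lemma finger_boundary:
  assumes "norm z = 1"
  shows "eventually (\<lambda>t. fst (finger t (\<phi> z)) = fst (\<phi> z)) at_top"
proof -
  have "\<phi> z \<noteq> \<phi> 0"
    using inj_onD[OF inj, of z 0] assms by auto
  then have "eventually (\<lambda>t. fst (push t (tilt t (\<phi> z))) = fst (\<phi> z)) at_top"
    using small[of z] assms by (intro push_tilt_eventually_trivial) (auto simp: centre)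
  then show ?thesis
    using assms by (simp add: finger_def squeeze_fixes_boundary)
qed

lemma finger_interior:
  assumes "norm z < 1"
  shows "filterlim (\<lambda>t. fst (finger t (\<phi> z))) at_top at_top"
proof (rule filterlim_at_top_mono)
  \<comment> \<open>One unit is lost in \<open>push_tilt_core\<close>, another to the first
    coordinate of the squeezed point, which is at least \<open>-1\<close>.\<close>
  show "filterlim (\<lambda>t::real. t - 2) at_top at_top"
    by (rule filterlim_tendsto_add_at_top[OF tendsto_const filterlim_ident, of "-2", simplified])
  define c where "c = 1 - norm z"
  have c: "0 < c" "c \<le> 1"
    using assms by (auto simp: c_def)
  \<comment> \<open>From time \<open>1 / c\<close> on, the denominator in \<open>shrink\<close>
    exceeds \<open>1 / D \<eta>\<close>, so the shrunk point has norm below \<open>D \<eta>\<close>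
    and \<open>\<phi>\<close> maps it into the core of the tube.\<close>
  have "t - 2 \<le> fst (finger t (\<phi> z))" if t: "t \<ge> 1 / c" for t
  proof -
    have "t > 0"
      using c t by (meson less_le_trans zero_less_divide_1_iff)
    define \<eta> where "\<eta> = 1 / (8 * (1 + t)^3)"
    define \<zeta> where "\<zeta> = shrink (rate t) z"
    have "D \<eta> > 0"
      using \<open>t > 0\<close> by (intro D_pos) (simp add: \<eta>_def)
    have r: "rate t = t / D \<eta>"
      by (simp add: rate_def \<eta>_def)
    have "1 \<le> t * c"
      using t c by (simp add: field_simps)
    then have "1 / D \<eta> \<le> rate t * c"
      using \<open>D \<eta> > 0\<close> by (simp add: r divide_right_mono)
    then have "1 / D \<eta> < 1 + rate t * (1 - norm z)"
      by (simp add: c_def)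
    then have "1 < D \<eta> * (1 + rate t * (1 - norm z))"
      using \<open>D \<eta> > 0\<close> by (simp add: field_simps)
    then have "norm z < D \<eta> * (1 + rate t * (1 - norm z))"
      using assms by linarith
    then have "norm \<zeta> < D \<eta>"
      unfolding \<zeta>_def
      using assms rate_nonneg[of t] \<open>t > 0\<close> shrink_denom_pos[of "rate t" z]
      by (simp add: norm_shrink pos_divide_less_eq)
    moreover have "norm \<zeta> \<le> 1"
      unfolding \<zeta>_def using bij_betw_shrink[OF rate_nonneg, THEN bij_betw_apply, of t z] \<open>t > 0\<close> assms
      by simp
    ultimately have "norm (\<phi> \<zeta>) < \<eta>" and "\<bar>fst (\<phi> \<zeta>)\<bar> \<le> 1"
      using modulus small by auto
    moreover have "squeeze t (\<phi> z) = \<phi> \<zeta>"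
      using assms by (auto simp: squeeze_def E_def \<zeta>_def)
    ultimately show ?thesis
      using push_tilt_core[of t "\<phi> \<zeta>"] \<open>t > 0\<close> by (auto simp: finger_def \<eta>_def)
  qed
  then show "eventually (\<lambda>t. t - 2 \<le> fst (finger t (\<phi> z))) at_top"
    unfolding eventually_at_top_linorder by blast
qed

section \<open>Uniform control in time, and sampling at slow times\<close>

text \<open>Horizontal displacements over the whole plane already occur on a compact rectangle:
  beyond the disk, \<open>tilt\<close> sees only the clipped first coordinate and the displacement
  by \<open>push\<close> only the height.\<close>

lemma finger_displacement_clip:
  assumes "0 \<le> t"
  shows "fst (finger t (x, y)) - x =
    fst (finger t (max (-2) (min 2 x), max (-1) (min 1 y))) - max (-2) (min 2 x)"
proof (cases "\<bar>y\<bar> < 1 / 4")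
  case True
  show ?thesis
  proof (cases "\<bar>x\<bar> \<le> 2")
    case False
    \<comment> \<open>Clipping at \<open>2\<close> rather than \<open>1\<close> keeps the clipped
      point off the disk, where \<open>\<bar>x\<bar> \<le> 1\<close>.\<close>
    then have "(x, y) \<notin> E" "(max (-2) (min 2 x), y) \<notin> E"
      using E_small[of "(x, y)"] E_small[of "(max (-2) (min 2 x), y)"] by auto
    then have "finger t (x, y) = push t (tilt t (x, y))"
      "finger t (max (-2) (min 2 x), y) = push t (tilt t (max (-2) (min 2 x), y))"
      by (simp_all only: finger_def squeeze_def if_False)
    moreover have "max (-1) (min 1 (max (-2) (min 2 x))) = max (-1) (min 1 x)"
      by simp
    then have "snd (tilt t (max (-2) (min 2 x), y)) = snd (tilt t (x, y))"
      by (simp only: tilt_def fst_conv snd_conv)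
    moreover have "max (-1) (min 1 y) = y"
      using True by linarith
    ultimately show ?thesis
      by (simp only: push_def fst_tilt fst_conv add_diff_cancel_left')
  next
    case True
    then have "max (-2) (min 2 x) = x" "max (-1) (min 1 y) = y"
      using \<open>\<bar>y\<bar> < 1 / 4\<close> by linarith+
    then show ?thesis
      by (simp only:)
  qed
next
  case False
  then have "1 / 4 \<le> \<bar>max (-1) (min 1 y)\<bar>"
    by linarith
  then have "finger t (x, y) = (x, y)"
    and "finger t (max (-2) (min 2 x), max (-1) (min 1 y)) = (max (-2) (min 2 x), max (-1) (min 1 y))"
    using False by (intro finger_outside assms; simp only: snd_conv not_less)+
  then show ?thesis
    by (simp only: fst_conv diff_self)
qed

text \<open>Uniform continuity on a compact set of times and clipped points carries over to the
  whole plane, because displacements agree at a point and at its clipped copy.\<close>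

lemma finger_uniform:
  assumes "e > 0"
  shows "\<exists>\<delta>>0. \<forall>s t v. 0 \<le> s \<longrightarrow> s \<le> B \<longrightarrow> 0 \<le> t \<longrightarrow> t \<le> B \<longrightarrow> \<bar>s - t\<bar> \<le> \<delta> \<longrightarrow>
    \<bar>fst (finger s v) - fst (finger t v)\<bar> < e"
proof -
  define K where "K = {0..B} \<times> ({-2..2::real} \<times> {-1..1::real})"
  have "continuous_on K (\<lambda>p. fst (finger (fst p) (snd p)))"
    by (intro continuous_intros continuous_on_subset[OF continuous_on_finger]) (auto simp: K_def)
  moreover have "compact K"
    unfolding K_def by (intro compact_Times compact_Icc)
  ultimately have "uniformly_continuous_on K (\<lambda>p. fst (finger (fst p) (snd p)))"
    by (rule compact_uniformly_continuous)
  then obtain d where d: "d > 0" "\<And>p q. \<lbrakk>p \<in> K; q \<in> K; dist q p < d\<rbrakk> \<Longrightarrow>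
      dist (fst (finger (fst q) (snd q))) (fst (finger (fst p) (snd p))) < e"
    unfolding uniformly_continuous_on_def using assms by metis
  show ?thesis
  proof (intro exI[of _ "d / 2"] conjI allI impI)
    fix s t and v :: "real \<times> real" assume *: "0 \<le> s" "s \<le> B" "0 \<le> t" "t \<le> B" "\<bar>s - t\<bar> \<le> d / 2"
    define w where "w = (max (-2) (min 2 (fst v)), max (-1) (min 1 (snd v)))"
    have eq: "fst (finger r v) - fst v = fst (finger r w) - fst w" if "0 \<le> r" for r
      using finger_displacement_clip[OF that, of "fst v" "snd v"]
      by (simp only: w_def prod.collapse fst_conv)
    have "w \<in> {-2..2} \<times> {-1..1}"
      by (simp add: w_def)
    then have "(t, w) \<in> K" "(s, w) \<in> K"
      using * by (simp_all add: K_def)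
    moreover have "dist (s, w) (t, w) < d"
      using * d(1) by (simp add: dist_Pair_Pair dist_real_def)
    ultimately have "\<bar>fst (finger s w) - fst (finger t w)\<bar> < e"
      using d(2)[of "(t, w)" "(s, w)"] by (simp add: dist_real_def)
    then show "\<bar>fst (finger s v) - fst (finger t v)\<bar> < e"
      using eq[OF *(1)] eq[OF *(3)] by linarith
  qed (use d in auto)
qed

lemma slow_fingers:
  obtains f :: "nat \<Rightarrow> real \<times> real \<Rightarrow> real \<times> real"
  where "\<And>v. f 0 v = v" "\<And>n. continuous_on UNIV (f n)" "\<And>n. bij (f n)"
    "\<And>n v. 1 / 4 \<le> \<bar>snd v\<bar> \<Longrightarrow> f n v = v"
    "\<And>e. e > 0 \<Longrightarrow> eventually (\<lambda>n. \<forall>v. \<bar>fst (f (Suc n) v) - fst (f n v)\<bar> < e) sequentially"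
    "\<And>z. norm z = 1 \<Longrightarrow> eventually (\<lambda>n. fst (f n (\<phi> z)) = fst (\<phi> z)) sequentially"
    "\<And>z. norm z < 1 \<Longrightarrow> filterlim (\<lambda>n. fst (f n (\<phi> z))) at_top sequentially"
proof -
  \<comment> \<open>With \<open>j = \<lfloor>t n\<rfloor>\<close>, the bound \<open>j + 2\<close>
    covers both \<open>t n\<close> and the next time, at most \<open>1\<close> later; the tolerance
    \<open>1 / (j + 1)\<close> tends to \<open>0\<close> as \<open>t n\<close> diverges.\<close>
  have "\<exists>\<delta>>0. \<forall>s t v. 0 \<le> s \<longrightarrow> s \<le> real j + 2 \<longrightarrow> 0 \<le> t \<longrightarrow> t \<le> real j + 2 \<longrightarrow> \<bar>s - t\<bar> \<le> \<delta> \<longrightarrow>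
    \<bar>fst (finger s v) - fst (finger t v)\<bar> < 1 / real (Suc j)" for j
    by (rule finger_uniform) simp
  then obtain \<delta> where \<delta>: "\<And>j. \<delta> j > 0" "\<And>j s t v. \<lbrakk>0 \<le> s; s \<le> real j + 2; 0 \<le> t; t \<le> real j + 2;
      \<bar>s - t\<bar> \<le> \<delta> j\<rbrakk> \<Longrightarrow> \<bar>fst (finger s v) - fst (finger t v)\<bar> < 1 / real (Suc j)"
    by metis
  obtain t where t: "t 0 = 0" "\<And>n. t n \<le> t (Suc n)" "\<And>n. t (Suc n) \<le> t n + 1"
    "\<And>n. t (Suc n) \<le> t n + \<delta> (nat \<lfloor>t n\<rfloor>)" "filterlim t at_top sequentially"
    using slow_sequence[of \<delta>] \<delta>(1) by metis
  have t0: "0 \<le> t n" for n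
    by (induction n) (use t(1,2) order_trans in auto)
  have step: "\<bar>fst (finger (t (Suc n)) v) - fst (finger (t n) v)\<bar> < 1 / real (Suc (nat \<lfloor>t n\<rfloor>))" for n v
  proof (rule \<delta>(2))
    have "t n \<le> real (nat \<lfloor>t n\<rfloor>) + 1"
      by linarith
    then show "t n \<le> real (nat \<lfloor>t n\<rfloor>) + 2" "t (Suc n) \<le> real (nat \<lfloor>t n\<rfloor>) + 2"
      using t(3)[of n] by linarith+
    show "\<bar>t (Suc n) - t n\<bar> \<le> \<delta> (nat \<lfloor>t n\<rfloor>)"
      using t(2,4)[of n] by simp
  qed (rule t0)+
  show ?thesis
  proof
    show "finger (t 0) v = v" for v
      by (simp add: t(1) finger_0)
    show "continuous_on UNIV (finger (t n))" "bij (finger (t n))" for n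
      using continuous_finger bij_finger t0 by auto
    show "finger (t n) v = v" if "1 / 4 \<le> \<bar>snd v\<bar>" for n v
      using finger_outside t0 that by auto
    show "eventually (\<lambda>n. \<forall>v. \<bar>fst (finger (t (Suc n)) v) - fst (finger (t n) v)\<bar> < e) sequentially"
      if "e > 0" for e
    proof -
      have "eventually (\<lambda>n. t n \<ge> 1 / e) sequentially"
        using t(5) by (simp add: filterlim_at_top)
      then show ?thesis
      proof eventually_elim
        case (elim n)
        have "1 / e < real (Suc (nat \<lfloor>t n\<rfloor>))"
          using elim by linarith
        then have "1 / real (Suc (nat \<lfloor>t n\<rfloor>)) < e"
          using that by (simp add: field_simps)
        with step show ?case
          using order_less_trans by blast
      qed
    qed
    show "eventually (\<lambda>n. fst (finger (t n) (\<phi> z)) = fst (\<phi> z)) sequentially" if "norm z = 1" for z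
      using eventually_compose_filterlim[OF finger_boundary[OF that] t(5)] .
    show "filterlim (\<lambda>n. fst (finger (t n) (\<phi> z))) at_top sequentially" if "norm z < 1" for z
      using filterlim_compose[OF finger_interior[OF that] t(5)] .
  qed
qed

end

subsection \<open>Stacking the strips\<close>

text \<open>Copies have height \<open>1\<close> and are centred at the integers. Copies
  \<open>n\<close> and \<open>-n\<close> carry the same map, so forward and backward orbits behave
  alike.\<close>

definition stack :: "(nat \<Rightarrow> real \<times> real \<Rightarrow> real \<times> real) \<Rightarrow> real \<times> real \<Rightarrow> real \<times> real" where
  "stack f w = (let n = round (snd w) in f (nat \<bar>n\<bar>) (w - (0, of_int n)) + (0, of_int n))"

text \<open>The formula of copy \<open>n\<close> persists into the neighbouring copies: a point
  there is at least \<open>1 / 4\<close> away from both centres, where both maps are the identity.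
  The overlaps provide an open cover for continuity.\<close>

lemma stack_local:
  assumes f: "\<And>n v. 1 / 4 \<le> \<bar>snd v\<bar> \<Longrightarrow> f n v = v" and "\<bar>snd w - of_int n\<bar> \<le> 3 / 4"
  shows "stack f w = f (nat \<bar>n\<bar>) (w - (0, of_int n)) + (0, of_int n)"
proof (cases "round (snd w) = n")
  case False
  define m where "m = round (snd w)"
  have m: "\<bar>snd w - of_int m\<bar> \<le> 1 / 2"
    using of_int_round_abs_le[of "snd w"] by (simp add: m_def abs_minus_commute)
  have "1 \<le> \<bar>m - n\<bar>"
    using False by (simp add: m_def)
  then have "1 \<le> \<bar>real_of_int m - real_of_int n\<bar>"
    by linarith
  then have "1 / 4 \<le> \<bar>snd (w - (0, of_int n))\<bar>" "1 / 4 \<le> \<bar>snd (w - (0, of_int m))\<bar>"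
    using m assms(2) by (simp_all only: snd_diff snd_conv)
  then show ?thesis
    by (simp add: stack_def f flip: m_def)
qed (simp add: stack_def)

text \<open>If \<open>g v\<close> lies where \<open>g\<close> is the identity, then
  \<open>g (g v) = g v\<close>, and injectivity gives \<open>g v = v\<close>.\<close>

lemma abs_snd_bij:
  fixes g :: "real \<times> real \<Rightarrow> real \<times> real"
  assumes out: "\<And>v. 1 / 4 \<le> \<bar>snd v\<bar> \<Longrightarrow> g v = v" and "inj g" and "\<bar>snd v\<bar> \<le> 1 / 2"
  shows "\<bar>snd (g v)\<bar> \<le> 1 / 2"
proof (cases "1 / 4 \<le> \<bar>snd (g v)\<bar>")
  case True
  then have "g v = v"
    using out assms(2) by (metis injD)
  with assms show ?thesis
    by simp
qed simp

lemma abs_snd_stack: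
  assumes "\<And>n v. 1 / 4 \<le> \<bar>snd v\<bar> \<Longrightarrow> f n v = v" "\<And>n. inj (f n)" "\<bar>snd w - of_int n\<bar> \<le> 1 / 2"
  shows "\<bar>snd (stack f w) - of_int n\<bar> \<le> 1 / 2"
proof -
  have "stack f w = f (nat \<bar>n\<bar>) (w - (0, of_int n)) + (0, of_int n)"
    using assms by (intro stack_local) auto
  then show ?thesis
    using abs_snd_bij[of "f (nat \<bar>n\<bar>)" "w - (0, of_int n)"] assms by simp
qed

lemma stack_inverse:
  assumes "\<And>n v. 1 / 4 \<le> \<bar>snd v\<bar> \<Longrightarrow> f n v = v" "\<And>n v. 1 / 4 \<le> \<bar>snd v\<bar> \<Longrightarrow> g n v = v" "\<And>n. inj (g n)"
    and fg: "\<And>n v. f n (g n v) = v"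
  shows "stack f (stack g w) = w"
proof -
  define n where "n = round (snd w)"
  have n: "\<bar>snd w - of_int n\<bar> \<le> 1 / 2"
    using of_int_round_abs_le[of "snd w"] by (simp add: n_def abs_minus_commute)
  have "\<bar>snd (stack g w) - of_int n\<bar> \<le> 1 / 2"
    by (intro abs_snd_stack assms n)
  then have "stack f (stack g w) = f (nat \<bar>n\<bar>) (stack g w - (0, of_int n)) + (0, of_int n)"
    by (intro stack_local assms) auto
  moreover have "stack g w = g (nat \<bar>n\<bar>) (w - (0, of_int n)) + (0, of_int n)"
    using n by (intro stack_local assms) auto
  ultimately show ?thesis
    by (simp add: fg)
qed

lemma continuous_stack:
  assumes "\<And>n v. 1 / 4 \<le> \<bar>snd v\<bar> \<Longrightarrow> f n v = v" "\<And>n. continuous_on UNIV (f n)"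
  shows "continuous_on UNIV (stack f)"
proof -
  define U where "U n = {w :: real \<times> real. \<bar>snd w - of_int n\<bar> < 3 / 4}" for n :: int
  have "continuous_on (\<Union>n\<in>UNIV. U n) (stack f)"
  proof (rule continuous_on_open_UN)
    show "open (U n)" for n
      unfolding U_def by (intro open_Collect_less continuous_intros)
    show "continuous_on (U n) (stack f)" for n
    proof (rule continuous_on_eq)
      show "continuous_on (U n) (\<lambda>w. f (nat \<bar>n\<bar>) (w - (0, of_int n)) + (0, of_int n))"
        by (intro continuous_intros continuous_on_compose2[OF assms(2)]) auto
      show "f (nat \<bar>n\<bar>) (w - (0, of_int n)) + (0, of_int n) = stack f w" if "w \<in> U n" for w
        using that by (intro stack_local[symmetric] assms) (auto simp: U_def)
    qed
  qed
  moreover have "w \<in> U (round (snd w))" for w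
    using of_int_round_abs_le[of "snd w"] unfolding U_def mem_Collect_eq by linarith
  then have "(\<Union>n\<in>UNIV. U n) = UNIV"
    by blast
  ultimately show ?thesis
    by simp
qed

text \<open>An instance of invariance of domain.\<close>

lemma continuous_inv:
  fixes f :: "'a::euclidean_space \<Rightarrow> 'a"
  assumes "continuous_on UNIV f" "bij f"
  shows "continuous_on UNIV (inv f)"
  using continuous_on_inverse_open[of UNIV f "inv f"] assms
  by (simp add: bij_is_inj bij_is_surj)

text \<open>Conjugating the unit shift by \<open>F\<close> replaces \<open>f\<close> at index
  \<open>\<bar>n\<bar>\<close> by \<open>f\<close> at \<open>\<bar>n + 1\<bar>\<close>; these
  indices are consecutive, so \<open>slow\<close> bounds the horizontal motion in distant
  copies.\<close>

lemma shift_conjugate: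
  fixes f :: "nat \<Rightarrow> real \<times> real \<Rightarrow> real \<times> real"
  assumes f0: "\<And>v. f 0 v = v" and cont: "\<And>n. continuous_on UNIV (f n)" and bij: "\<And>n. bij (f n)"
    and out: "\<And>n v. 1 / 4 \<le> \<bar>snd v\<bar> \<Longrightarrow> f n v = v"
    and slow: "\<And>e. e > 0 \<Longrightarrow> eventually (\<lambda>n. \<forall>v. \<bar>fst (f (Suc n) v) - fst (f n v)\<bar> < e) sequentially"
  obtains H where "continuous_on UNIV H" "bij H" "\<And>z. \<bar>snd (H z) - snd z\<bar> \<le> 3"
    "\<And>e. e > 0 \<Longrightarrow> \<exists>M. \<forall>z. M \<le> \<bar>snd z\<bar> \<longrightarrow> \<bar>fst (H z) - fst z\<bar> < e"
    "\<And>v n. \<bar>snd v\<bar> \<le> 1 / 2 \<Longrightarrow> H (f (nat \<bar>n\<bar>) v + (0, of_int n)) = f (nat \<bar>n + 1\<bar>) v + (0, of_int (n + 1))"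
proof -
  define F where "F = stack f"
  define F' where "F' = stack (\<lambda>n. inv (f n))"
  define H where "H = (\<lambda>z. F (F' z + (0, 1)))"
  have inv_out: "inv (f n) v = v" if "1 / 4 \<le> \<bar>snd v\<bar>" for n v
    using out[OF that] bij by (metis bij_inv_eq_iff)
  have FF': "F (F' w) = w" and F'F: "F' (F w) = w" for w
    unfolding F_def F'_def using bij
    by (auto intro!: stack_inverse out inv_out simp: bij_is_inj bij_imp_bij_inv surj_f_inv_f bij_is_surj)
  have contF: "continuous_on UNIV F" "continuous_on UNIV F'"
    unfolding F_def F'_def by (intro continuous_stack out inv_out cont continuous_inv bij; assumption)+
  have close: "\<bar>snd (F w) - snd w\<bar> \<le> 1" for w
  proof -
    have "\<bar>snd w - of_int (round (snd w))\<bar> \<le> 1 / 2"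
      using of_int_round_abs_le[of "snd w"] by (simp add: abs_minus_commute)
    moreover from this have "\<bar>snd (F w) - of_int (round (snd w))\<bar> \<le> 1 / 2"
      unfolding F_def by (intro abs_snd_stack out bij_is_inj bij)
    ultimately show ?thesis
      by linarith
  qed
  have F_eq: "F (v + (0, of_int n)) = f (nat \<bar>n\<bar>) v + (0, of_int n)" if "\<bar>snd v\<bar> \<le> 1 / 2" for v n
    using that stack_local[of f "v + (0, of_int n)" n] out by (simp add: F_def)
  have H_eq: "H (f (nat \<bar>n\<bar>) v + (0, of_int n)) = f (nat \<bar>n + 1\<bar>) v + (0, of_int (n + 1))"
    if "\<bar>snd v\<bar> \<le> 1 / 2" for v n
    using F_eq[OF that, of "n + 1"] by (simp add: H_def F'F add.assoc flip: F_eq[OF that, of n])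
  show ?thesis
  proof
    show "continuous_on UNIV H"
      unfolding H_def by (intro continuous_intros continuous_on_compose2[OF contF(1)] contF(2)) auto
    show "bij H"
      by (rule bij_betw_byWitness[where f' = "\<lambda>z. F (F' z - (0, 1))"]) (auto simp: H_def FF' F'F)
    \<comment> \<open>Each of \<open>F'\<close>, the shift and \<open>F\<close> changes the height
      by at most \<open>1\<close>.\<close>
    show "\<bar>snd (H z) - snd z\<bar> \<le> 3" for z
      using close[of "F' z"] close[of "F' z + (0, 1)"] by (simp add: H_def FF')
    show "\<exists>M. \<forall>z. M \<le> \<bar>snd z\<bar> \<longrightarrow> \<bar>fst (H z) - fst z\<bar> < e" if "e > 0" for e
    proof -
      obtain N where N: "\<And>n v. n \<ge> N \<Longrightarrow> \<bar>fst (f (Suc n) v) - fst (f n v)\<bar> < e"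
        using slow[OF \<open>e > 0\<close>] by (auto simp: eventually_sequentially)
      \<comment> \<open>The margin \<open>4\<close> absorbs the change of height under
        \<open>F'\<close>, the rounding, and the drop of the index by one when \<open>n\<close> is
        negative.\<close>
      have "\<bar>fst (H z) - fst z\<bar> < e" if z: "real N + 4 \<le> \<bar>snd z\<bar>" for z
      proof -
        define n where "n = round (snd (F' z))"
        define v where "v = F' z - (0, of_int n)"
        have v: "\<bar>snd v\<bar> \<le> 1 / 2"
          using of_int_round_abs_le[of "snd (F' z)"] by (simp add: v_def n_def abs_minus_commute)
        have z_eq: "z = f (nat \<bar>n\<bar>) v + (0, of_int n)"
          using F_eq[OF v, of n] by (simp add: v_def FF')
        have fst: "fst (H z) - fst z = fst (f (nat \<bar>n + 1\<bar>) v) - fst (f (nat \<bar>n\<bar>) v)"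
          using H_eq[OF v, of n] by (simp flip: z_eq) (simp add: z_eq)
        have "\<bar>snd z - snd (F' z)\<bar> \<le> 1" "snd (F' z) = snd v + of_int n"
          using close[of "F' z"] by (simp_all add: FF' v_def)
        then have "real N + 1 \<le> \<bar>real_of_int n\<bar>"
          using z v by linarith
        then have "int N + 1 \<le> \<bar>n\<bar>"
          by linarith
        then have "nat \<bar>n + 1\<bar> = Suc (nat \<bar>n\<bar>) \<and> nat \<bar>n\<bar> \<ge> N \<or> nat \<bar>n\<bar> = Suc (nat \<bar>n + 1\<bar>) \<and> nat \<bar>n + 1\<bar> \<ge> N"
          by linarith
        then show ?thesis
          unfolding fst using N by (metis abs_minus_commute)
      qed
      then show ?thesis
        by blast
    qed
  qed (fact H_eq)
qed

subsection \<open>Compressing the plane into a strip\<close>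

text \<open>A homeomorphism of the plane onto the open strip \<open>\<bar>y\<bar> < 1\<close>, with
  inverse \<open>unflatten\<close> on that strip.\<close>

definition flatten :: "real \<times> real \<Rightarrow> real \<times> real" where
  "flatten w = (fst w, snd w / (1 + \<bar>snd w\<bar>))"

definition unflatten :: "real \<times> real \<Rightarrow> real \<times> real" where
  "unflatten z = (fst z, snd z / (1 - \<bar>snd z\<bar>))"

lemma unflatten_flatten [simp]: "unflatten (flatten w) = w"
proof -
  have "1 + \<bar>snd w\<bar> > 0"
    by linarith
  then have "1 - \<bar>snd w / (1 + \<bar>snd w\<bar>)\<bar> = 1 / (1 + \<bar>snd w\<bar>)"
    by (simp add: field_simps)
  with \<open>1 + \<bar>snd w\<bar> > 0\<close> show ?thesis
    by (simp add: flatten_def unflatten_def)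
qed

lemma flatten_unflatten: "\<bar>snd z\<bar> < 1 \<Longrightarrow> flatten (unflatten z) = z"
proof -
  assume "\<bar>snd z\<bar> < 1"
  then have "1 + \<bar>snd z / (1 - \<bar>snd z\<bar>)\<bar> = 1 / (1 - \<bar>snd z\<bar>)"
    by (simp add: field_simps)
  with \<open>\<bar>snd z\<bar> < 1\<close> show ?thesis
    by (simp add: flatten_def unflatten_def)
qed

lemma abs_snd_flatten: "\<bar>snd (flatten w)\<bar> < 1"
proof -
  have "1 + \<bar>snd w\<bar> > 0"
    by linarith
  then show ?thesis
    by (simp add: flatten_def)
qed

lemma continuous_flatten: "continuous_on UNIV flatten"
proof -
  have "1 + \<bar>snd w\<bar> \<noteq> 0" for w :: "real \<times> real"
    by linarith
  then show ?thesis
    unfolding flatten_def[abs_def] by (intro continuous_intros) auto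
qed

lemma continuous_unflatten: "continuous_on {z. \<bar>snd z\<bar> < 1} unflatten"
  unfolding unflatten_def[abs_def] by (intro continuous_intros) auto

text \<open>Far out, a bounded shift preserves the sign, and both values lie within
  \<open>e / 2\<close> of the same limit \<open>1\<close> or \<open>-1\<close>.\<close>

lemma flatten_shift_small:
  fixes s s' :: real
  assumes "\<bar>s' - s\<bar> \<le> B" "e > 0" "B + 2 / e \<le> \<bar>s\<bar>"
  shows "\<bar>s' / (1 + \<bar>s'\<bar>) - s / (1 + \<bar>s\<bar>)\<bar> < e"
proof -
  have "2 / e > 0"
    using assms by simp
  then have s: "2 / e \<le> \<bar>s\<bar>" "2 / e \<le> \<bar>s'\<bar>" and "s > 0 \<and> s' > 0 \<or> s < 0 \<and> s' < 0"
    using assms by linarith+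
  then have sgn: "sgn s' = sgn s"
    by auto
  have eq: "r / (1 + \<bar>r\<bar>) = sgn r * (1 - 1 / (1 + \<bar>r\<bar>))" for r :: real
  proof -
    have "1 + \<bar>r\<bar> > 0"
      by linarith
    then show ?thesis
      by (simp add: field_simps sgn_if abs_if split: if_splits)
  qed
  have lt: "1 / (1 + \<bar>r\<bar>) < e / 2" "0 < 1 / (1 + \<bar>r\<bar>)" if "2 / e \<le> \<bar>r\<bar>" for r
  proof -
    have "2 / e < 1 + \<bar>r\<bar>" "1 + \<bar>r\<bar> > 0"
      using that by linarith+
    then show "1 / (1 + \<bar>r\<bar>) < e / 2" "0 < 1 / (1 + \<bar>r\<bar>)"
      using assms(2) by (simp_all add: field_simps)
  qed
  have "s' / (1 + \<bar>s'\<bar>) - s / (1 + \<bar>s\<bar>) = sgn s * (1 / (1 + \<bar>s\<bar>) - 1 / (1 + \<bar>s'\<bar>))"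
    unfolding eq[of s] eq[of s'] sgn by (simp add: algebra_simps)
  then have "\<bar>s' / (1 + \<bar>s'\<bar>) - s / (1 + \<bar>s\<bar>)\<bar> \<le> \<bar>1 / (1 + \<bar>s\<bar>) - 1 / (1 + \<bar>s'\<bar>)\<bar>"
    by (simp add: abs_mult abs_sgn_eq)
  also have "\<dots> < e"
    using lt[OF s(1)] lt[OF s(2)] by linarith
  finally show ?thesis .
qed

text \<open>Near the edges of the strip the flattened map is close to the identity: horizontally by
  \<open>fst\<close>, vertically because a bounded shift is compressed. Hence the extension by the
  identity is continuous.\<close>

lemma flatten_extension:
  assumes cont: "continuous_on UNIV H" and bij: "bij H" and snd: "\<And>z. \<bar>snd (H z) - snd z\<bar> \<le> B"
    and fst: "\<And>e. e > 0 \<Longrightarrow> \<exists>M. \<forall>z. M \<le> \<bar>snd z\<bar> \<longrightarrow> \<bar>fst (H z) - fst z\<bar> < e"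
  obtains h where "continuous_on UNIV h" "bij h" "\<And>w. h (flatten w) = flatten (H w)"
proof -
  define S where "S = {z :: real \<times> real. \<bar>snd z\<bar> < 1}"
  define h where "h z = (if z \<in> S then flatten (H (unflatten z)) else z)" for z
  have "open S"
    unfolding S_def by (intro open_Collect_less continuous_intros)
  have near: "\<exists>d>0. \<forall>z. 1 - d < \<bar>snd z\<bar> \<longrightarrow> dist (h z) z < e" if "e > 0" for e
  proof -
    obtain M where M: "\<And>z. M \<le> \<bar>snd z\<bar> \<Longrightarrow> \<bar>fst (H z) - fst z\<bar> < e / 2"
      using fst[OF half_gt_zero[OF \<open>e > 0\<close>]] by metis
    define K where "K = max M (B + 2 / (e / 2))"
    \<comment> \<open>Inside the strip, \<open>1 - d < \<bar>snd z\<bar>\<close> says exactly that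
      \<open>unflatten z\<close> has height above \<open>\<bar>K\<bar>\<close> in absolute
      value.\<close>
    define d where "d = 1 / (1 + \<bar>K\<bar>)"
    have "dist (h z) z < e" if z: "1 - d < \<bar>snd z\<bar>" for z
    proof (cases "z \<in> S")
      case True
      define w where "w = unflatten z"
      have "1 - \<bar>snd z\<bar> > 0"
        using True by (simp add: S_def)
      have "1 - \<bar>snd z\<bar> < 1 / (1 + \<bar>K\<bar>)" "1 + \<bar>K\<bar> > 0"
        using z by (auto simp: d_def)
      then have "(1 - \<bar>snd z\<bar>) * (1 + \<bar>K\<bar>) < 1"
        by (simp add: field_simps)
      then have "\<bar>K\<bar> * (1 - \<bar>snd z\<bar>) < \<bar>snd z\<bar>"
        by (simp add: algebra_simps)
      then have "\<bar>K\<bar> < \<bar>snd w\<bar>"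
        using \<open>1 - \<bar>snd z\<bar> > 0\<close> by (simp add: w_def unflatten_def pos_less_divide_eq)
      then have "M \<le> \<bar>snd w\<bar>" "B + 2 / (e / 2) \<le> \<bar>snd w\<bar>"
        unfolding K_def by linarith+
      then have "\<bar>fst (H w) - fst w\<bar> < e / 2" "B + 2 / (e / 2) \<le> \<bar>snd w\<bar>"
        using M by blast+
      moreover from this have "\<bar>snd (flatten (H w)) - snd (flatten w)\<bar> < e / 2"
        unfolding flatten_def snd_conv using \<open>e > 0\<close> by (intro flatten_shift_small[OF snd]) auto
      moreover have "h z = flatten (H w)" "z = flatten w"
        using True by (auto simp: h_def w_def S_def flatten_unflatten)
      moreover have "dist p q \<le> \<bar>fst p - fst q\<bar> + \<bar>snd p - snd q\<bar>" for p q :: "real \<times> real"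
        by (simp add: dist_prod_def dist_real_def sqrt_sum_squares_le_sum_abs)
      ultimately show ?thesis
        by (smt (verit, best) field_sum_of_halves flatten_def fst_conv)
    qed (use \<open>e > 0\<close> in \<open>simp add: h_def\<close>)
    moreover have "d > 0"
      by (simp add: d_def add_pos_nonneg)
    ultimately show ?thesis
      by blast
  qed
  have "isCont h z" for z
  proof (cases "z \<in> S")
    case True
    have "continuous_on S (\<lambda>z. flatten (H (unflatten z)))"
      using continuous_unflatten
      by (intro continuous_on_compose2[OF continuous_flatten] continuous_on_compose2[OF cont]) (auto simp: S_def)
    then have "continuous_on S h"
      by (rule continuous_on_eq) (simp add: h_def)
    with True \<open>open S\<close> show ?thesis
      by (simp add: continuous_on_eq_continuous_at)
  next
    case False
    show ?thesis
      unfolding continuous_at_eps_delta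
    proof (intro allI impI)
      fix e :: real assume "e > 0"
      then obtain d where d: "d > 0" "\<And>z. 1 - d < \<bar>snd z\<bar> \<Longrightarrow> dist (h z) z < e / 2"
        using near[of "e / 2"] by auto
      have "dist (h z') (h z) < e" if "dist z' z < min d (e / 2)" for z'
      proof -
        have "\<bar>snd z' - snd z\<bar> < d"
          using dist_snd_le[of z' z] that by (simp add: dist_real_def)
        then have "1 - d < \<bar>snd z'\<bar>"
          using False by (simp add: S_def)
        from d(2)[OF this] have "dist (h z') z < e"
          using dist_triangle[of "h z'" z z'] that by simp
        with False show ?thesis
          by (simp add: h_def)
      qed
      then show "\<exists>d>0. \<forall>z'. dist z' z < d \<longrightarrow> dist (h z') (h z) < e"
        using d(1) \<open>e > 0\<close> by (intro exI[of _ "min d (e / 2)"]) auto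
    qed
  qed
  then have "continuous_on UNIV h"
    by (simp add: continuous_on_eq_continuous_at)
  moreover have "bij h"
  proof (rule bij_betw_byWitness[where f' = "\<lambda>z. if z \<in> S then flatten (inv H (unflatten z)) else z"])
    have "flatten w \<in> S" for w
      by (simp add: S_def abs_snd_flatten)
    then show "\<forall>z\<in>UNIV. (if h z \<in> S then flatten (inv H (unflatten (h z))) else h z) = z"
      "\<forall>z\<in>UNIV. h (if z \<in> S then flatten (inv H (unflatten z)) else z) = z"
      using bij by (auto simp: h_def S_def flatten_unflatten bij_is_inj bij_is_surj surj_f_inv_f)
  qed auto
  moreover have "h (flatten w) = flatten (H w)" for w
    by (simp add: h_def S_def abs_snd_flatten)
  ultimately show ?thesis
    using that by blast
qed

subsection \<open>Transfer to an arbitrary disk\<close>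

text \<open>Invariance of domain in both directions: for \<open>\<phi>\<close> it keeps the open
  ball off the frontier, for \<open>\<psi>\<close> it keeps interior points off the sphere.\<close>

lemma disk_parametrization:
  fixes E :: "(real^2) set"
  assumes "disk E"
  obtains \<phi> :: "real^2 \<Rightarrow> real^2" where "continuous_on (cball 0 1) \<phi>" "inj_on \<phi> (cball 0 1)"
    "\<And>x. x \<in> frontier E \<Longrightarrow> \<exists>z. norm z = 1 \<and> \<phi> z = x"
    "\<And>y. y \<in> interior E \<Longrightarrow> \<exists>z. norm z < 1 \<and> \<phi> z = y"
proof -
  obtain \<psi> \<phi> where hom: "homeomorphism E (cball (0::real^2) 1) \<psi> \<phi>"
    using assms by (auto simp: disk_def homeomorphic_def)
  then have cont: "continuous_on (cball 0 1) \<phi>" "continuous_on E \<psi>"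
    and img: "\<phi> ` cball 0 1 = E" "\<psi> ` E = cball 0 1"
    and inv: "\<And>z. z \<in> cball 0 1 \<Longrightarrow> \<psi> (\<phi> z) = z" "\<And>x. x \<in> E \<Longrightarrow> \<phi> (\<psi> x) = x"
    by (auto simp: homeomorphism_def)
  have inj: "inj_on \<phi> (cball 0 1)" "inj_on \<psi> E"
    using inv by (metis inj_on_inverseI)+
  have "open (\<phi> ` ball 0 1)"
    using cont(1) inj(1) ball_subset_cball
    by (intro invariance_of_domain) (auto intro: continuous_on_subset inj_on_subset)
  then have ball: "\<phi> ` ball 0 1 \<subseteq> interior E"
    using img(1) ball_subset_cball by (intro interior_maximal) blast+
  have "open (\<psi> ` interior E)"
    using cont(2) inj(2) interior_subset
    by (intro invariance_of_domain) (auto intro: continuous_on_subset inj_on_subset)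
  then have int: "\<psi> ` interior E \<subseteq> interior (cball 0 1)"
    using img(2) interior_subset by (intro interior_maximal) blast+
  have "closed E"
    using compact_continuous_image[OF cont(1) compact_cball] by (simp add: img compact_imp_closed)
  show ?thesis
  proof (rule that[OF cont(1) inj(1)])
    fix x assume x: "x \<in> frontier E"
    then have "x \<in> E"
      using \<open>closed E\<close> frontier_subset_closed by blast
    then have "\<phi> (\<psi> x) = x" "\<psi> x \<in> cball 0 1"
      using inv img by auto
    moreover have "\<psi> x \<notin> ball 0 1"
      using x ball \<open>\<phi> (\<psi> x) = x\<close> by (metis DiffE frontier_def image_subset_iff)
    ultimately show "\<exists>z. norm z = 1 \<and> \<phi> z = x"
      by (intro exI[of _ "\<psi> x"]) auto
  next
    fix y assume "y \<in> interior E"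
    then show "\<exists>z. norm z < 1 \<and> \<phi> z = y"
      using int inv(2) interior_subset[THEN subsetD] by (intro exI[of _ "\<psi> y"]) auto
  qed
qed

section \<open>Affine coordinates around a point\<close>

definition chart :: "real \<Rightarrow> real^2 \<Rightarrow> real^2 \<Rightarrow> real \<times> real" where
  "chart r p x = (r * (x $ 1 - p $ 1), r * (x $ 2 - p $ 2))"

definition unchart :: "real \<Rightarrow> real^2 \<Rightarrow> real \<times> real \<Rightarrow> real^2" where
  "unchart r p w = p + (fst w / r) *\<^sub>R axis 1 1 + (snd w / r) *\<^sub>R axis 2 1"

lemma unchart_nth: "unchart r p w $ 1 = p $ 1 + fst w / r" "unchart r p w $ 2 = p $ 2 + snd w / r"
  by (simp_all add: unchart_def axis_def)

lemma unchart_chart [simp]: "r > 0 \<Longrightarrow> unchart r p (chart r p x) = x"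
  by (simp add: vec_eq_iff forall_2 unchart_nth chart_def)

lemma chart_unchart [simp]: "r > 0 \<Longrightarrow> chart r p (unchart r p w) = w"
  by (simp add: chart_def unchart_nth)

lemma continuous_on_chart: "continuous_on S (chart r p)"
  unfolding chart_def[abs_def] by (intro continuous_intros)

lemma continuous_on_unchart: "continuous_on S (unchart r p)"
  unfolding unchart_def[abs_def] divide_inverse by (intro continuous_intros)

section \<open>Assembling the homeomorphism of the plane\<close>

theorem theorem1p2:
  fixes E :: "(real^2) set"
  assumes "disk E"
  shows "\<exists>h k :: real^2 \<Rightarrow> real^2.
           homeomorphism UNIV UNIV h k \<and>
           (\<forall>x \<in> frontier E. bounded (orbit x h)) \<and>
           (\<forall>y \<in> interior E. doubly_divergent y h)"
proof -
  obtain \<phi>0 :: "real^2 \<Rightarrow> real^2" where \<phi>0: "continuous_on (cball 0 1) \<phi>0" "inj_on \<phi>0 (cball 0 1)"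
    "\<And>x. x \<in> frontier E \<Longrightarrow> \<exists>z. norm z = 1 \<and> \<phi>0 z = x"
    "\<And>y. y \<in> interior E \<Longrightarrow> \<exists>z. norm z < 1 \<and> \<phi>0 z = y"
    using disk_parametrization[OF assms] by metis
  define p where "p = \<phi>0 0"
  have "bounded ((\<lambda>z. \<phi>0 z - p) ` cball 0 1)"
    by (intro compact_imp_bounded compact_continuous_image continuous_intros \<phi>0(1) compact_cball)
  then obtain R where R: "R > 0" "\<And>z. norm z \<le> 1 \<Longrightarrow> norm (\<phi>0 z - p) \<le> R"
    unfolding bounded_pos by auto
  \<comment> \<open>This scale puts the disk into
    \<open>\<bar>x\<bar>, \<bar>y\<bar> \<le> 1 / 16\<close>; unflattening then raises heights to at
    most \<open>1 / 15\<close>, within the bound \<open>1 / 8\<close> of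
    \<open>small\<close>.\<close>
  define r where "r = 1 / (16 * R)"
  have "r > 0"
    using R by (simp add: r_def)
  define C where "C = chart r p"
  have C: "\<bar>fst (C (\<phi>0 z))\<bar> \<le> 1 / 16 \<and> \<bar>snd (C (\<phi>0 z))\<bar> \<le> 1 / 16" if "norm z \<le> 1" for z
  proof -
    have "\<bar>r * (\<phi>0 z $ i - p $ i)\<bar> \<le> 1 / 16" for i
    proof -
      have "\<bar>\<phi>0 z $ i - p $ i\<bar> \<le> R"
        using component_le_norm_cart[of "\<phi>0 z - p" i] R(2)[OF that] by simp
      then have "r * \<bar>\<phi>0 z $ i - p $ i\<bar> \<le> r * R"
        using \<open>r > 0\<close> by (intro mult_left_mono) auto
      with R \<open>r > 0\<close> show ?thesis
        by (simp add: abs_mult r_def)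
    qed
    then show ?thesis
      by (simp add: C_def chart_def)
  qed
  \<comment> \<open>The stacked strips live in the unflattened plane, so the disk is unflattened
    first; flattening copy \<open>0\<close> then returns the original disk.\<close>
  define \<phi> where "\<phi> z = unflatten (C (\<phi>0 z))" for z
  have flatten_\<phi>: "flatten (\<phi> z) = C (\<phi>0 z)" if "norm z \<le> 1" for z
    using C[OF that] by (simp add: \<phi>_def flatten_unflatten)
  have cont: "continuous_on (cball 0 1) \<phi>"
    unfolding \<phi>_def
  proof (rule continuous_on_compose2[OF continuous_unflatten])
    show "continuous_on (cball 0 1) (\<lambda>z. C (\<phi>0 z))"
      unfolding C_def by (rule continuous_on_compose2[OF continuous_on_chart \<phi>0(1)]) auto
    show "(\<lambda>z. C (\<phi>0 z)) ` cball 0 1 \<subseteq> {z. \<bar>snd z\<bar> < 1}"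
    proof (rule image_subsetI)
      fix z :: "real^2" assume "z \<in> cball 0 1"
      then show "C (\<phi>0 z) \<in> {z. \<bar>snd z\<bar> < 1}"
        using C[of z] by simp
    qed
  qed
  have inj: "inj_on \<phi> (cball 0 1)"
  proof (rule inj_onI)
    fix z w assume "z \<in> cball 0 1" "w \<in> cball 0 1" "\<phi> z = \<phi> w"
    then have "C (\<phi>0 z) = C (\<phi>0 w)"
      by (metis flatten_\<phi> mem_cball_0)
    then have "\<phi>0 z = \<phi>0 w"
      using \<open>r > 0\<close> by (metis C_def unchart_chart)
    then show "z = w"
      using \<phi>0(2) \<open>z \<in> cball 0 1\<close> \<open>w \<in> cball 0 1\<close> by (metis inj_onD)
  qed
  have centre: "\<phi> 0 = 0"
    by (simp add: \<phi>_def C_def p_def chart_def unflatten_def zero_prod_def)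
  have small: "\<bar>fst (\<phi> z)\<bar> \<le> 1 \<and> \<bar>snd (\<phi> z)\<bar> \<le> 1 / 8" if "norm z \<le> 1" for z
  proof -
    have "\<bar>snd (C (\<phi>0 z))\<bar> / (1 - \<bar>snd (C (\<phi>0 z))\<bar>) \<le> 1 / 8"
      using C[OF that] by (simp add: pos_divide_le_eq)
    with C[OF that] show ?thesis
      by (simp add: \<phi>_def unflatten_def)
  qed
  obtain D :: "real \<Rightarrow> real" where D: "continuous_on UNIV D" "\<And>\<eta>. \<eta> > 0 \<Longrightarrow> D \<eta> > 0"
    "\<And>\<eta> z. \<lbrakk>norm z \<le> 1; norm z < D \<eta>\<rbrakk> \<Longrightarrow> norm (\<phi> z) < \<eta>"
    using continuous_modulus_at_0[OF cont centre] by metis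
  interpret centred_disk \<phi> D
    by unfold_locales (use cont inj centre small D in auto)
  obtain f :: "nat \<Rightarrow> real \<times> real \<Rightarrow> real \<times> real" where f: "\<And>v. f 0 v = v"
    "\<And>n. continuous_on UNIV (f n)" "\<And>n. bij (f n)" "\<And>n v. 1 / 4 \<le> \<bar>snd v\<bar> \<Longrightarrow> f n v = v"
    "\<And>e. e > 0 \<Longrightarrow> eventually (\<lambda>n. \<forall>v. \<bar>fst (f (Suc n) v) - fst (f n v)\<bar> < e) sequentially"
    and bdry: "\<And>z. norm z = 1 \<Longrightarrow> eventually (\<lambda>n. fst (f n (\<phi> z)) = fst (\<phi> z)) sequentially"
    and intr: "\<And>z. norm z < 1 \<Longrightarrow> filterlim (\<lambda>n. fst (f n (\<phi> z))) at_top sequentially"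
    by (rule slow_fingers) blast
  obtain H where H: "continuous_on UNIV H" "bij H" "\<And>z. \<bar>snd (H z) - snd z\<bar> \<le> 3"
    "\<And>e. e > 0 \<Longrightarrow> \<exists>M. \<forall>z. M \<le> \<bar>snd z\<bar> \<longrightarrow> \<bar>fst (H z) - fst z\<bar> < e"
    and H_step: "\<And>v n. \<bar>snd v\<bar> \<le> 1 / 2 \<Longrightarrow>
      H (f (nat \<bar>n\<bar>) v + (0, of_int n)) = f (nat \<bar>n + 1\<bar>) v + (0, of_int (n + 1))"
    by (rule shift_conjugate[of f]) (use f in blast)+
  obtain g where g: "continuous_on UNIV g" "bij g" "\<And>w. g (flatten w) = flatten (H w)"
    by (rule flatten_extension[of H 3]) (use H in blast)+
  define h where "h = (\<lambda>x. unchart r p (g (C x)))"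
  have "bij h"
    by (rule bij_betw_byWitness[where f' = "\<lambda>x. unchart r p (inv g (C x))"])
       (use \<open>r > 0\<close> g(2) in \<open>auto simp: h_def C_def bij_is_inj bij_is_surj surj_f_inv_f\<close>)
  have "continuous_on UNIV h"
    unfolding h_def C_def
    by (intro continuous_on_compose2[OF continuous_on_unchart] continuous_on_compose2[OF g(1)] continuous_on_chart) auto
  then have hom: "homeomorphism UNIV UNIV h (inv h)"
    using \<open>bij h\<close> continuous_inv[of h]
    by (auto simp: homeomorphism_def bij_is_inj bij_is_surj surj_f_inv_f bij_imp_bij_inv)
  \<comment> \<open>At time \<open>n\<close> the point sits in copy \<open>n\<close>, moved by
    \<open>f\<close> at index \<open>\<bar>n\<bar>\<close>; at \<open>n = 0\<close> this is the
    starting point since \<open>f 0\<close> is the identity.\<close>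
  have iter: "iter h n (\<phi>0 z) = unchart r p (flatten (f (nat \<bar>n\<bar>) (\<phi> z) + (0, of_int n)))"
    if z: "norm z \<le> 1" for z n
  proof (rule iter_eqI[OF \<open>bij h\<close>])
    show "unchart r p (flatten (f (nat \<bar>0\<bar>) (\<phi> z) + (0, of_int 0))) = \<phi>0 z"
      using \<open>r > 0\<close> by (simp add: f(1) flatten_\<phi>[OF z] C_def flip: zero_prod_def)
    show "h (unchart r p (flatten (f (nat \<bar>n\<bar>) (\<phi> z) + (0, of_int n)))) =
      unchart r p (flatten (f (nat \<bar>n + 1\<bar>) (\<phi> z) + (0, of_int (n + 1))))" for n
    proof -
      have "\<bar>snd (\<phi> z)\<bar> \<le> 1 / 2"
        using small[OF z] by simp
      then show ?thesis
        using \<open>r > 0\<close> by (simp only: h_def C_def chart_unchart g(3) H_step)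
    qed
  qed
  show ?thesis
  proof (intro exI conjI ballI)
    show "homeomorphism UNIV UNIV h (inv h)"
      by (fact hom)
  next
    fix x assume "x \<in> frontier E"
    then obtain z where z: "norm z = 1" "\<phi>0 z = x"
      using \<phi>0(3) by blast
    \<comment> \<open>Eventually constant first coordinates are bounded, and flattening bounds the
      second ones.\<close>
    have "convergent (\<lambda>n. fst (f n (\<phi> z)))"
      using tendsto_eventually[OF bdry[OF z(1)]] by (auto simp: convergent_def)
    then obtain B where B: "\<And>n. \<bar>fst (f n (\<phi> z))\<bar> \<le> B"
      using convergent_imp_Bseq by (metis BseqE real_norm_def)
    have "iter h n x \<in> unchart r p ` ({-B..B} \<times> {-1..1})" for n
    proof -
      define w where "w = f (nat \<bar>n\<bar>) (\<phi> z) + (0, of_int n)"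
      have "fst (flatten w) \<in> {-B..B}"
        using B[of "nat \<bar>n\<bar>"] by (auto simp: flatten_def w_def)
      moreover have "snd (flatten w) \<in> {-1..1}"
        using abs_snd_flatten[of w] by auto
      ultimately have "flatten w \<in> {-B..B} \<times> {-1..1}"
        by (simp add: mem_Times_iff)
      then show ?thesis
        using iter[of z n] z by (auto simp: w_def)
    qed
    then have "orbit x h \<subseteq> unchart r p ` ({-B..B} \<times> {-1..1})"
      by (auto simp: orbit_def)
    moreover have "bounded (unchart r p ` ({-B..B} \<times> {-1..1}))"
      by (intro compact_imp_bounded compact_continuous_image continuous_on_unchart compact_Times compact_Icc)
    ultimately show "bounded (orbit x h)"
      by (rule bounded_subset[rotated])
  next
    fix y assume "y \<in> interior E"
    then obtain z where z: "norm z < 1" "\<phi>0 z = y"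
      using \<phi>0(4) by blast
    have "filterlim (\<lambda>n. fst (f n (\<phi> z)) * (1 / r)) at_top sequentially"
      by (rule filterlim_at_top_mult_tendsto_pos[OF tendsto_const _ intr[OF z(1)]]) (simp add: \<open>r > 0\<close>)
    then have lim: "filterlim (\<lambda>n. p $ 1 + fst (f n (\<phi> z)) * (1 / r)) at_top sequentially"
      by (rule filterlim_tendsto_add_at_top[OF tendsto_const])
    \<comment> \<open>Flattening preserves first coordinates, so their divergence alone forces the
      norm to infinity; the index \<open>\<bar>n\<bar>\<close> serves both time directions.\<close>
    have le: "p $ 1 + fst (f (nat \<bar>n\<bar>) (\<phi> z)) * (1 / r) \<le> dist (iter h n y) 0" for n
    proof -
      have "iter h n y $ 1 = p $ 1 + fst (f (nat \<bar>n\<bar>) (\<phi> z)) * (1 / r)"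
        using iter[of z n] z by (simp add: unchart_nth flatten_def)
      then show ?thesis
        using component_le_norm_cart[of "iter h n y" 1] by simp
    qed
    show "doubly_divergent y h"
      unfolding doubly_divergent_def positively_divergent_def negatively_divergent_def
      using filterlim_at_top_mono[OF lim always_eventually] le[of "int _"] le[of "- int _"] by simp
  qed
qed

end
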